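(* We have $P(2)=5$. Moreover, up to similarity, the unique optimal configuration for $k=2$ is the five-point set consisting of the four vertices of a square together with the center of the square.
   Context: For a set $\mathcal{P} \subset \mathbb{R}^2$, let $A(\mathcal{P})$ be the number of distinct values in the open interval $(0,\pi)$ taken by the angle magnitudes $|\angle abc|$ (the angle at $b$ between the rays from $b$ through $a$ and from $b$ through $c$, measured in $[0,\pi]$), where $a,b,c$ range over triples of distinct points of $\mathcal{P}$. In particular, angles equal to $0$ or $\pi$ are not counted. For an integer $k\ge 1$, define $$P(k) := \max\{\#\mathcal{P} : \mathcal{P}\subseteq \mathbb{R}^2,\ \text{not all points of } \mathcal{P} \text{ are collinear},\ A(\mathcal{P}) \leq k\}.$$ An optimal configuration for $k$ is a set $\mathcal{P}\subseteq\mathbb{R}^2$, not all of whose points are collinear, with $A(\mathcal{P})\le k$ and $\#\mathcal{P}=P(k)$. Configurations are considered up to similarity, i.e. up to rigid motions (including reflections) and dilations of the plane. *)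

theory Defs
  imports "HOL-Analysis.Analysis" "HOL-Library.Extended_Nat"
begin

text \<open>\<open>card\<close> sends infinite sets to \<open>0\<close>, so sizes are measured in \<^typ>\<open>enat\<close>. Neither an
  infinite point set nor an infinite set of angles can then pass for a small one.\<close>

definition ecard :: "'a set \<Rightarrow> enat" where
  "ecard S = (if finite S then enat (card S) else \<infinity>)"

text \<open>The magnitude of the angle at \<open>b\<close>, in \<open>[0, \<pi>]\<close>; meaningful for \<open>a \<noteq> b\<close> and \<open>c \<noteq> b\<close>.\<close>

definition angle_at :: "real^2 \<Rightarrow> real^2 \<Rightarrow> real^2 \<Rightarrow> real" where
  "angle_at a b c = arccos (((a - b) \<bullet> (c - b)) / (norm (a - b) * norm (c - b)))"

definition angles :: "(real^2) set \<Rightarrow> real set" where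
  "angles S = {angle_at a b c | a b c.
     a \<in> S \<and> b \<in> S \<and> c \<in> S \<and> a \<noteq> b \<and> b \<noteq> c \<and> a \<noteq> c} \<inter> {0<..<pi}"

definition num_angles :: "(real^2) set \<Rightarrow> enat" where
  "num_angles S = ecard (angles S)"

definition admissible :: "nat \<Rightarrow> (real^2) set \<Rightarrow> bool" where
  "admissible k S \<longleftrightarrow> \<not> collinear S \<and> num_angles S \<le> enat k"

text \<open>The maximal size is a supremum in \<^typ>\<open>enat\<close>, hence never unspecified. A supremum that is
  finite and positive is an attained maximum, see \<open>max_points_eq_iff\<close>.\<close>

definition max_points :: "nat \<Rightarrow> enat" where
  "max_points k = Sup {ecard S | S. admissible k S}"

definition optimal :: "nat \<Rightarrow> (real^2) set \<Rightarrow> bool" where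
  "optimal k S \<longleftrightarrow> admissible k S \<and> ecard S = max_points k"

definition similar :: "(real^2) set \<Rightarrow> (real^2) set \<Rightarrow> bool" where
  "similar S T \<longleftrightarrow> (\<exists>r f t. r > 0 \<and> orthogonal_transformation f \<and>
     T = (\<lambda>x. t + r *\<^sub>R f x) ` S)"

definition square_with_center :: "(real^2) set" where
  "square_with_center =
     {vector [1, 1], vector [-1, 1], vector [-1, -1], vector [1, -1], vector [0, 0]}"

lemma Sup_enat_eq_iff:
  assumes "n > 0"
  shows "Sup X = enat n \<longleftrightarrow> enat n \<in> X \<and> (\<forall>x\<in>X. x \<le> enat n)"
proof
  assume s: "Sup X = enat n"
  have ne: "X \<noteq> {}"
    using s assms by (auto simp: bot_enat_def enat_0_iff)
  then have "Sup X = (if finite X then Max X else \<infinity>)"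
    by (simp add: Sup_enat_def)
  then have "finite X" "Max X = enat n"
    using s by (simp_all split: if_splits)
  with ne show "enat n \<in> X \<and> (\<forall>x\<in>X. x \<le> enat n)"
    using Max_in[of X] Max_ge[of X] by simp
next
  assume "enat n \<in> X \<and> (\<forall>x\<in>X. x \<le> enat n)"
  then show "Sup X = enat n"
    by (intro antisym Sup_least Sup_upper) auto
qed

lemma max_points_eq_iff:
  assumes "n > 0"
  shows "max_points k = enat n \<longleftrightarrow>
    (\<exists>S. admissible k S \<and> finite S \<and> card S = n) \<and>
    (\<forall>S. admissible k S \<longrightarrow> finite S \<and> card S \<le> n)"
proof -
  have le: "ecard S \<le> enat n \<longleftrightarrow> finite S \<and> card S \<le> n" for S :: "(real^2) set"
    by (simp add: ecard_def)
  have eq: "enat n = ecard S \<longleftrightarrow> finite S \<and> card S = n" for S :: "(real^2) set"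
    by (auto simp: ecard_def)
  let ?X = "{ecard S | S. admissible k S}"
  have "enat n \<in> ?X \<longleftrightarrow> (\<exists>S. admissible k S \<and> finite S \<and> card S = n)"
    using eq by auto
  moreover have "(\<forall>x\<in>?X. x \<le> enat n) \<longleftrightarrow> (\<forall>S. admissible k S \<longrightarrow> ecard S \<le> enat n)"
    by blast
  ultimately show ?thesis
    unfolding max_points_def Sup_enat_eq_iff[OF assms] by (simp only: le)
qed

end

theory Submission
  imports Defs
begin

text \<open>
  A nondegenerate triangle whose three angles take at most two values is isosceles. If a set \<open>S\<close>
  determines at most two angles, then all nondegenerate triangles in \<open>S\<close> moreover have the same
  shape: with base-to-leg ratio \<open>l\<close>, the cosines are \<open>l / 2\<close> at the base and \<open>1 - l\<^sup>2 / 2\<close> at the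
  apex, and two different ratios would need more than two cosines
  (\<open>admissible_imp_similar_isosceles_triangles\<close>). This turns the angle condition into a condition
  on distances, and there are two cases.

  Suppose that \<open>S\<close> contains no three collinear points, and let \<open>a\<close> be the apex of a triangle
  \<open>a b c\<close> in \<open>S\<close>. For a fourth point \<open>d\<close>, the triangles \<open>a b d\<close>, \<open>a c d\<close> and \<open>b c d\<close> are
  isosceles with ratio \<open>l\<close>, and every choice of their apexes forces \<open>d\<close> to have the same distance
  from \<open>b\<close> and \<open>c\<close> as \<open>a\<close> has, so that \<open>d = b + c - a\<close> (\<open>fourth_point_general_position\<close>). Hence
  \<open>S\<close> has at most four points.

  Suppose that \<open>q\<close> lies between \<open>p\<close> and \<open>r\<close> in \<open>S\<close>, and let \<open>c\<close> be a point of \<open>S\<close> off their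
  line. The two angles at \<open>q\<close> are supplementary, which for angles of a single isosceles shape is
  possible only if both are right; the legs then give
  \<open>\<bar>qp\<bar> = \<bar>qc\<bar> = \<bar>qr\<bar>\<close> (\<open>right_angle_at_middle\<close>). So every point off the line is one of two
  points, and a fourth point on the line would produce a second foot of the perpendicular from
  \<open>c\<close>. Hence \<open>S\<close> is contained in a square with its center
  (\<open>collinear_triple_imp_subset_centered_square\<close>).

  Conversely, the square with its center determines only the angles \<open>\<pi> / 4\<close> and \<open>\<pi> / 2\<close>, and
  similarities preserve angles.
\<close>

section \<open>Isosceles triangles and their cosines\<close>

text \<open>On \<open>[0, \<pi>]\<close> an angle is determined by its cosine, and relations between the cosines and the
  sides of a triangle are algebraic.\<close>

definition cosine_at :: "real^2 \<Rightarrow> real^2 \<Rightarrow> real^2 \<Rightarrow> real" where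
  "cosine_at a b c = ((a - b) \<bullet> (c - b)) / (norm (a - b) * norm (c - b))"

text \<open>The apex is the first of the three points.\<close>

definition isosceles_with_ratio :: "real \<Rightarrow> real^2 \<Rightarrow> real^2 \<Rightarrow> real^2 \<Rightarrow> bool" where
  "isosceles_with_ratio l a b c \<longleftrightarrow> dist a b = dist a c \<and> dist b c = l * dist a b"

text \<open>The distance-only form of the hypothesis that at most two angles occur.\<close>

definition similar_isosceles_triangles :: "real \<Rightarrow> (real^2) set \<Rightarrow> bool" where
  "similar_isosceles_triangles l S \<longleftrightarrow> (\<forall>a\<in>S. \<forall>b\<in>S. \<forall>c\<in>S. \<not> collinear {a, b, c} \<longrightarrow>
     isosceles_with_ratio l a b c \<or> isosceles_with_ratio l b a c \<or> isosceles_with_ratio l c a b)"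

definition quarter_turn :: "real^2 \<Rightarrow> real^2" where
  "quarter_turn u = vector [- u $ 2, u $ 1]"

lemma cosine_at_commute: "cosine_at a b c = cosine_at c b a"
  by (simp add: cosine_at_def inner_commute mult.commute)

lemma abs_cosine_at_less_one:
  assumes "\<not> collinear {a, b, c}"
  shows "\<bar>cosine_at a b c\<bar> < 1"
proof -
  have ne: "a \<noteq> b" "c \<noteq> b"
    using assms by (auto simp: insert_commute)
  have "\<not> collinear {0, a - b, c - b}"
    using assms collinear_3[of a b c] by simp
  then have "\<bar>(a - b) \<bullet> (c - b)\<bar> \<noteq> norm (a - b) * norm (c - b)"
    by (simp add: norm_cauchy_schwarz_equal)
  then have "\<bar>(a - b) \<bullet> (c - b)\<bar> < norm (a - b) * norm (c - b)"
    using Cauchy_Schwarz_ineq2[of "a - b" "c - b"] by linarith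
  then show ?thesis
    using ne by (simp add: cosine_at_def abs_mult divide_less_eq)
qed

lemma law_of_cosines:
  assumes "a \<noteq> b" "c \<noteq> b"
  shows "2 * dist a b * dist c b * cosine_at a b c = (dist a b)\<^sup>2 + (dist c b)\<^sup>2 - (dist a c)\<^sup>2"
proof -
  have "dist a b * dist c b * cosine_at a b c = (a - b) \<bullet> (c - b)"
    using assms by (simp add: cosine_at_def dist_norm)
  moreover have "(dist a c)\<^sup>2 = (dist a b)\<^sup>2 + (dist c b)\<^sup>2 - 2 * ((a - b) \<bullet> (c - b))"
    by (simp add: dist_norm power2_norm_eq_inner inner_diff_left inner_diff_right inner_commute)
  ultimately show ?thesis by linarith
qed

lemma strict_triangle_inequality:
  fixes a b c :: "real^2"
  assumes "\<not> collinear {a, b, c}"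
  shows "dist b c < dist b a + dist a c"
proof -
  have "\<not> between (b, c) a"
    using assms collinear_between_cases by blast
  then show ?thesis
    using dist_triangle[of b c a] by (simp add: between)
qed

text \<open>The law of cosines at both base vertices gives \<open>(B - C) * ((B + C)\<^sup>2 - A\<^sup>2) = 0\<close> for the side
  lengths \<open>A\<close>, \<open>B\<close>, \<open>C\<close>, and the second factor is positive by the strict triangle
  inequality.\<close>

lemma equal_cosines_imp_isosceles:
  assumes nc: "\<not> collinear {a, b, c}" and eq: "cosine_at a b c = cosine_at a c b"
  shows "dist a b = dist a c"
proof -
  have ne: "a \<noteq> b" "b \<noteq> c" "a \<noteq> c"
    using nc by (auto simp: insert_commute)
  let ?A = "dist b c" and ?B = "dist a c" and ?C = "dist a b" and ?t = "cosine_at a b c"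
  have 1: "2 * ?C * ?A * ?t = ?C\<^sup>2 + ?A\<^sup>2 - ?B\<^sup>2"
    using law_of_cosines[of a b c] ne by (simp add: dist_commute)
  have 2: "2 * ?B * ?A * ?t = ?B\<^sup>2 + ?A\<^sup>2 - ?C\<^sup>2"
    using law_of_cosines[of a c b] ne eq by (simp add: dist_commute)
  have "?B * (?C\<^sup>2 + ?A\<^sup>2 - ?B\<^sup>2) = ?C * (?B\<^sup>2 + ?A\<^sup>2 - ?C\<^sup>2)"
    by (simp flip: 1 2)
  then have "(?B - ?C) * ((?B + ?C)\<^sup>2 - ?A\<^sup>2) = 0"
    by algebra
  moreover have "?A < ?B + ?C"
    using strict_triangle_inequality[OF nc] by (simp add: dist_commute)
  then have "?A\<^sup>2 < (?B + ?C)\<^sup>2"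
    by (intro power_strict_mono) auto
  then have "(?B + ?C)\<^sup>2 - ?A\<^sup>2 \<noteq> 0" by linarith
  ultimately have "?B - ?C = 0" by (auto simp only: mult_eq_0_iff)
  then show ?thesis by simp
qed

lemma isosceles_cosines:
  assumes nc: "\<not> collinear {a, b, c}" and iso: "isosceles_with_ratio l a b c"
  shows "cosine_at a b c = l / 2" "cosine_at a c b = l / 2" "cosine_at b a c = 1 - l\<^sup>2 / 2"
    "0 < l" "l < 2"
proof -
  have ne: "a \<noteq> b" "b \<noteq> c" "a \<noteq> c"
    using nc by (auto simp: insert_commute)
  define s where "s = dist a b"
  have s: "s > 0" "dist a b = s" "dist b a = s" "dist a c = s" "dist c a = s"
      "dist b c = l * s" "dist c b = l * s"
    using iso ne by (auto simp: s_def isosceles_with_ratio_def dist_commute)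
  have "0 < l * s"
    using ne s by (metis zero_less_dist_iff)
  then show l: "0 < l"
    using s by (simp add: zero_less_mult_iff)
  show "l < 2"
    using strict_triangle_inequality[OF nc] s by simp
  have "(2 * l * s\<^sup>2) * cosine_at a b c = (2 * l * s\<^sup>2) * (l / 2)"
    using law_of_cosines[of a b c] ne s by (simp add: power2_eq_square algebra_simps)
  then show "cosine_at a b c = l / 2"
    using l s(1) by simp
  have "(2 * l * s\<^sup>2) * cosine_at a c b = (2 * l * s\<^sup>2) * (l / 2)"
    using law_of_cosines[of a c b] ne s by (simp add: power2_eq_square algebra_simps)
  then show "cosine_at a c b = l / 2"
    using l s(1) by simp
  have "(2 * s\<^sup>2) * cosine_at b a c = (2 * s\<^sup>2) * (1 - l\<^sup>2 / 2)"
    using law_of_cosines[of b a c] ne s by (simp add: power2_eq_square algebra_simps)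
  then show "cosine_at b a c = 1 - l\<^sup>2 / 2"
    using s(1) by simp
qed

section \<open>Two angles allow a single shape of triangle\<close>

lemma two_cosines:
  assumes "admissible 2 S"
  shows "\<exists>p q. \<forall>a\<in>S. \<forall>b\<in>S. \<forall>c\<in>S. \<not> collinear {a, b, c} \<longrightarrow> cosine_at a b c \<in> {p, q}"
proof -
  have fin: "finite (angles S)" and card: "card (angles S) \<le> 2"
    using assms by (auto simp: admissible_def num_angles_def ecard_def split: if_splits)
  have "\<exists>x y. angles S \<subseteq> {x, y}"
  proof -
    consider "card (angles S) = 0" | "card (angles S) = 1" | "card (angles S) = 2"
      using card by linarith
    then show ?thesis
      using fin by cases (auto simp: card_1_singleton_iff card_2_iff)
  qed
  then obtain x y where xy: "angles S \<subseteq> {x, y}" by blast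
  have "cosine_at a b c \<in> {cos x, cos y}"
    if "a \<in> S" "b \<in> S" "c \<in> S" and nc: "\<not> collinear {a, b, c}" for a b c
  proof -
    have ne: "a \<noteq> b" "b \<noteq> c" "a \<noteq> c"
      using nc by (auto simp: insert_commute)
    have bd: "- 1 < cosine_at a b c" "cosine_at a b c < 1"
      using abs_cosine_at_less_one[OF nc] by auto
    have "angle_at a b c \<in> {0<..<pi}"
      using arccos_lt_bounded[OF bd] by (simp add: angle_at_def cosine_at_def)
    then have "angle_at a b c \<in> angles S"
      using that ne by (auto simp: angles_def)
    moreover have "cos (angle_at a b c) = cosine_at a b c"
      using bd by (simp add: angle_at_def flip: cosine_at_def)
    ultimately show ?thesis
      using xy by auto
  qed
  then show ?thesis by blast
qed

text \<open>Here \<open>x\<close> and \<open>y\<close> are the base cosines of two isosceles triangles and \<open>p\<close>, \<open>q\<close> the available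
  cosines. If \<open>x \<noteq> y\<close> then these are the only available ones, so either some triangle is equilateral,
  which forces the value \<open>1 / 2\<close> on both, or each apex cosine is the other base cosine. The latter
  gives \<open>x + y = 1 / 2\<close> and \<open>x\<^sup>2 + y\<^sup>2 = 3 / 4\<close>, as for \<open>cos (\<pi> / 5)\<close> and
  \<open>cos (3 * \<pi> / 5)\<close>; then one of them is negative, so it is not a base cosine.\<close>

lemma isosceles_ratio_unique:
  fixes x y p q :: real
  assumes pos: "0 < x" "0 < y"
    and x: "x \<in> {p, q}" "1 - 2 * x\<^sup>2 \<in> {p, q}" and y: "y \<in> {p, q}" "1 - 2 * y\<^sup>2 \<in> {p, q}"
  shows "x = y"
proof (rule ccontr)
  assume ne: "x \<noteq> y"
  have half: "z = 1 / 2" if "0 < z" "1 - 2 * z\<^sup>2 = z" for z :: real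
  proof -
    have "(2 * z - 1) * (z + 1) = 0"
      using that(2) by (simp add: power2_eq_square algebra_simps)
    then show ?thesis using that(1) by simp
  qed
  have half': "z = 1 / 2" if "0 < z" "1 - 2 * z\<^sup>2 = 1 / 2" for z :: real
  proof -
    have "(2 * z - 1) * (2 * z + 1) = 0"
      using that(2) by (simp add: power2_eq_square algebra_simps)
    then show ?thesis using that(1) by simp
  qed
  \<comment> \<open>As \<open>x\<close> and \<open>y\<close> are distinct elements of \<open>{p, q}\<close>, the two sets agree.\<close>
  have "1 - 2 * x\<^sup>2 \<in> {x, y}" "1 - 2 * y\<^sup>2 \<in> {x, y}"
    using ne x y by auto
  then consider "1 - 2 * x\<^sup>2 = x" "1 - 2 * y\<^sup>2 \<in> {x, y}" | "1 - 2 * y\<^sup>2 = y" "1 - 2 * x\<^sup>2 \<in> {x, y}"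
    | "1 - 2 * x\<^sup>2 = y" "1 - 2 * y\<^sup>2 = x"
    by auto
  then show False
  proof cases
    case 1
    then show False using half half' pos ne by (metis insertE singletonD)
  next
    case 2
    then show False using half half' pos ne by (metis insertE singletonD)
  next
    case 3
    have "(x - y) * (2 * (x + y) - 1) = 0"
      using 3 by (simp add: power2_eq_square algebra_simps)
    then have s: "x + y = 1 / 2" using ne by simp
    have "x\<^sup>2 + y\<^sup>2 = 3 / 4"
      using 3 s by simp
    moreover have "x\<^sup>2 + y\<^sup>2 + 2 * (x * y) = 1 / 4"
      using arg_cong[OF s, of "\<lambda>z. z\<^sup>2"] by (simp add: power2_sum power_divide)
    moreover have "0 < x * y" using pos by simp
    ultimately show False by linarith
  qed
qed

text \<open>By the pigeonhole principle two angles of each triangle agree, so it is isosceles; the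
  previous lemma shows that its ratio does not depend on the triangle.\<close>

lemma admissible_imp_similar_isosceles_triangles:
  assumes "admissible 2 S"
  obtains l where "similar_isosceles_triangles l S"
proof -
  obtain p q where
    "\<forall>a\<in>S. \<forall>b\<in>S. \<forall>c\<in>S. \<not> collinear {a, b, c} \<longrightarrow> cosine_at a b c \<in> {p, q}"
    using two_cosines[OF assms] by (elim exE) (rule that)
  then have pq: "cosine_at a b c \<in> {p, q}"
    if "a \<in> S" "b \<in> S" "c \<in> S" "\<not> collinear {a, b, c}" for a b c
    using that by fast
  let ?T = "\<lambda>l a b c. isosceles_with_ratio l a b c \<or> isosceles_with_ratio l b a c
    \<or> isosceles_with_ratio l c a b"
  let ?R = "\<lambda>l. 0 < l \<and> l / 2 \<in> {p, q} \<and> 1 - l\<^sup>2 / 2 \<in> {p, q}"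
  have apex: "\<exists>l. ?R l \<and> isosceles_with_ratio l a b c"
    if S: "a \<in> S" "b \<in> S" "c \<in> S" and nc: "\<not> collinear {a, b, c}"
      and eq: "cosine_at a b c = cosine_at a c b" for a b c
  proof -
    have iso: "isosceles_with_ratio (dist b c / dist a b) a b c"
      using equal_cosines_imp_isosceles[OF nc eq] nc
      by (auto simp: isosceles_with_ratio_def)
    have "\<not> collinear {b, a, c}"
      using nc by (simp add: insert_commute)
    then have "cosine_at b a c \<in> {p, q}" "cosine_at a b c \<in> {p, q}"
      using pq S nc by blast+
    then show ?thesis
      using iso isosceles_cosines[OF nc iso] by metis
  qed
  have tri: "\<exists>l. ?R l \<and> ?T l a b c"
    if S: "a \<in> S" "b \<in> S" "c \<in> S" and nc: "\<not> collinear {a, b, c}" for a b c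
  proof -
    have nc': "\<not> collinear {b, a, c}" "\<not> collinear {c, a, b}" "\<not> collinear {a, c, b}"
      using nc by (simp_all add: insert_commute)
    have "cosine_at a b c \<in> {p, q}" "cosine_at b a c \<in> {p, q}" "cosine_at a c b \<in> {p, q}"
      using pq S nc nc' by blast+
    then consider "cosine_at a b c = cosine_at a c b" | "cosine_at b a c = cosine_at b c a"
      | "cosine_at c a b = cosine_at c b a"
      by (auto simp: cosine_at_commute)
    then show ?thesis
      using apex[OF S nc] apex[of b a c] apex[of c a b] S nc' by cases blast+
  qed
  have uniq: "l = l'" if "?R l" "?R l'" for l l'
    using isosceles_ratio_unique[of "l / 2" "l' / 2" p q] that
    by (simp add: power_divide)
  show ?thesis
  proof (cases "\<exists>l. ?R l")
    case True
    then obtain l where l: "?R l" by blast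
    have "similar_isosceles_triangles l S"
      unfolding similar_isosceles_triangles_def using tri uniq[OF l] by metis
    then show ?thesis by (rule that)
  next
    case False
    \<comment> \<open>No triangle is nondegenerate here, so any ratio will do.\<close>
    then have "similar_isosceles_triangles 0 S"
      unfolding similar_isosceles_triangles_def using tri by metis
    then show ?thesis by (rule that)
  qed
qed

section \<open>Sets without collinear triples\<close>

lemma quarter_turn_nth [simp]: "quarter_turn u $ 1 = - u $ 2" "quarter_turn u $ 2 = u $ 1"
  by (simp_all add: quarter_turn_def)

lemma inner_real2: "(x :: real^2) \<bullet> y = x $ 1 * y $ 1 + x $ 2 * y $ 2"
  by (simp add: inner_vec_def sum_2)

lemma norm_quarter_turn [simp]: "norm (quarter_turn u) = norm u"
  by (simp add: norm_eq_sqrt_inner inner_real2 algebra_simps)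

lemma orthogonal_real2:
  fixes u w :: "real^2"
  assumes "u \<noteq> 0" "w \<bullet> u = 0"
  obtains k where "w = k *\<^sub>R quarter_turn u"
proof -
  have n: "u \<bullet> u \<noteq> 0" using assms by simp
  let ?k = "(w \<bullet> quarter_turn u) / (u \<bullet> u)"
  have o: "w $ 1 * u $ 1 + w $ 2 * u $ 2 = 0"
    using assms(2) by (simp add: inner_real2)
  have "w $ 1 * (u \<bullet> u) = (w \<bullet> quarter_turn u) * - u $ 2"
    "w $ 2 * (u \<bullet> u) = (w \<bullet> quarter_turn u) * u $ 1"
    using o unfolding inner_real2 quarter_turn_nth by algebra+
  then have "w = ?k *\<^sub>R quarter_turn u"
    using n by (simp add: vec_eq_iff forall_2 nonzero_eq_divide_eq)
  then show ?thesis by (rule that)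
qed

lemma orthogonal_real2_same_norm:
  fixes u w :: "real^2"
  assumes "u \<noteq> 0" "w \<bullet> u = 0" "norm w = norm u"
  shows "w = quarter_turn u \<or> w = - quarter_turn u"
proof -
  obtain k where k: "w = k *\<^sub>R quarter_turn u"
    using orthogonal_real2 assms by blast
  then have "\<bar>k\<bar> = 1" using assms by simp
  then show ?thesis using k by (auto simp: abs_if split: if_splits)
qed

text \<open>Both \<open>a\<close> and \<open>d\<close> lie on the perpendicular bisector of \<open>b\<close> and \<open>c\<close>, at the same distance
  from its midpoint \<open>m\<close>. As they differ, they are mirror images in \<open>m\<close>.\<close>

lemma rhombus:
  fixes a b c d :: "real^2"
  assumes d: "dist a b = dist a c" "dist d b = dist a b" "dist d c = dist a b" and ne: "a \<noteq> d" "b \<noteq> c"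
  shows "d = b + c - a"
proof -
  define m where "m = (1 / 2) *\<^sub>R (b + c)"
  define u where "u = (1 / 2) *\<^sub>R (c - b)"
  have b: "b = m - u" and c: "c = m + u"
    by (simp_all add: m_def u_def vec_eq_iff field_simps)
  have u: "u \<noteq> 0" using ne by (simp add: u_def)
  have sq: "(dist z b)\<^sup>2 = (norm (z - m))\<^sup>2 + (norm u)\<^sup>2 + 2 * ((z - m) \<bullet> u)"
     "(dist z c)\<^sup>2 = (norm (z - m))\<^sup>2 + (norm u)\<^sup>2 - 2 * ((z - m) \<bullet> u)" for z
    by (simp_all add: b c dist_norm power2_norm_eq_inner algebra_simps inner_commute)
  have "(dist a b)\<^sup>2 = (dist a c)\<^sup>2" "(dist d b)\<^sup>2 = (dist a b)\<^sup>2" "(dist d c)\<^sup>2 = (dist a b)\<^sup>2"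
    using d by simp_all
  then have o: "(a - m) \<bullet> u = 0" "(d - m) \<bullet> u = 0" and n: "(norm (a - m))\<^sup>2 = (norm (d - m))\<^sup>2"
    unfolding sq by linarith+
  obtain k where k: "a - m = k *\<^sub>R quarter_turn u" using orthogonal_real2[OF u o(1)] .
  obtain j where j: "d - m = j *\<^sub>R quarter_turn u" using orthogonal_real2[OF u o(2)] .
  have "k\<^sup>2 = j\<^sup>2" using n u by (simp add: k j power_mult_distrib)
  moreover have "a - m \<noteq> d - m" using ne by simp
  then have "k \<noteq> j" using k j by auto
  ultimately have "j = - k" by (auto simp: power2_eq_iff)
  then have "d - m = - (a - m)" using k j by simp
  then show ?thesis by (simp add: b c algebra_simps)
qed

text \<open>Write \<open>s\<close> for the leg of \<open>a b c\<close> and \<open>x\<close>, \<open>y\<close>, \<open>z\<close> for the distances of \<open>d\<close> from \<open>a\<close>,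
  \<open>b\<close>, \<open>c\<close>. Each of the three triangles at \<open>d\<close> has three possible apexes. Every combination
  without \<open>y = z = s\<close> leads to \<open>l = 1\<close>, where all distances are equal anyway. The equilateral
  combination, although impossible in the plane, has \<open>y = z = s\<close> too.\<close>

lemma fourth_point_general_position:
  assumes sim: "similar_isosceles_triangles l S"
    and S: "a \<in> S" "b \<in> S" "c \<in> S" "d \<in> S"
    and nc: "\<not> collinear {a, b, c}" "\<not> collinear {a, b, d}" "\<not> collinear {a, c, d}" "\<not> collinear {b, c, d}"
    and iso: "isosceles_with_ratio l a b c"
  shows "d = b + c - a"
proof -
  have ne: "a \<noteq> d" "b \<noteq> c" using nc by (auto simp: insert_commute)
  define s x y z where "s = dist a b" and "x = dist d a" and "y = dist d b" and "z = dist d c"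
  have s: "s > 0" using nc by (auto simp: s_def)
  have l: "l > 0" using isosceles_cosines[OF nc(1) iso] by simp
  have ab: "dist a b = s" "dist b a = s" "dist a c = s" "dist c a = s" "dist b c = l * s" "dist c b = l * s"
    using iso by (auto simp: s_def isosceles_with_ratio_def dist_commute)
  have xyz: "dist d a = x" "dist a d = x" "dist d b = y" "dist b d = y" "dist d c = z" "dist c d = z"
    by (simp_all add: x_def y_def z_def dist_commute)
  have tri:
    "isosceles_with_ratio l a b d \<or> isosceles_with_ratio l b a d \<or> isosceles_with_ratio l d a b"
    "isosceles_with_ratio l a c d \<or> isosceles_with_ratio l c a d \<or> isosceles_with_ratio l d a c"
    "isosceles_with_ratio l b c d \<or> isosceles_with_ratio l c b d \<or> isosceles_with_ratio l d b c"
    using sim S nc unfolding similar_isosceles_triangles_def by blast+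
  have abd: "(x = s \<and> y = l * s) \<or> (y = s \<and> x = l * s) \<or> (x = y \<and> s = l * x)"
    and acd: "(x = s \<and> z = l * s) \<or> (z = s \<and> x = l * s) \<or> (x = z \<and> s = l * x)"
    and bcd: "(y = l * s \<and> z = l * (l * s)) \<or> (z = l * s \<and> y = l * (l * s)) \<or> (y = z \<and> s = y)"
    using tri l by (auto simp: isosceles_with_ratio_def ab xyz)
  have one: "l = 1" if "s = l * (l * s) \<or> s = l * s"
  proof -
    have "l * l = 1 \<or> l = 1" using that s by (auto simp flip: mult.assoc)
    moreover have "l \<noteq> - 1" using l by simp
    ultimately show ?thesis by (metis square_eq_1_iff)
  qed
  have "y = s \<and> z = s"
  proof (rule ccontr)
    assume neg: "\<not> (y = s \<and> z = s)"
    \<comment> \<open>Names for the products make the case distinction on the apexes a linear problem.\<close>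
    define t w v where "t = l * s" and "w = l * t" and "v = l * x"
    have "x = s \<Longrightarrow> v = t" "x = t \<Longrightarrow> v = w" "t = w \<Longrightarrow> s = t"
      using l by (simp_all add: t_def w_def v_def)
    moreover have "(x = s \<and> y = t) \<or> (y = s \<and> x = t) \<or> (x = y \<and> s = v)"
      "(x = s \<and> z = t) \<or> (z = s \<and> x = t) \<or> (x = z \<and> s = v)"
      "(y = t \<and> z = w) \<or> (z = t \<and> y = w) \<or> (y = z \<and> s = y)"
      using abd acd bcd unfolding t_def w_def v_def by fast+
    ultimately have "s = w \<or> s = t"
      using neg by (smt (verit))
    then have "s = l * (l * s) \<or> s = l * s"
      by (simp only: t_def w_def)
    then have "l = 1" by (rule one)
    with abd acd bcd neg show False by auto
  qed
  then have "dist d b = dist a b" "dist d c = dist a b" "dist a b = dist a c"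
    by (simp_all add: ab xyz)
  then show ?thesis using rhombus ne by blast
qed

lemma no_collinear_triple_imp_four_points:
  assumes sim: "similar_isosceles_triangles l S" and ncS: "\<not> collinear S"
    and gen: "\<And>a b c. a \<in> S \<Longrightarrow> b \<in> S \<Longrightarrow> c \<in> S \<Longrightarrow> a \<noteq> b \<Longrightarrow> b \<noteq> c \<Longrightarrow> a \<noteq> c \<Longrightarrow>
      \<not> collinear {a, b, c}"
  obtains a b c where "S \<subseteq> {a, b, c, b + c - a}"
proof -
  have "\<exists>a b. a \<in> S \<and> b \<in> S \<and> a \<noteq> b"
  proof (rule ccontr)
    assume "\<not> ?thesis"
    then have "S = {} \<or> (\<exists>a. S = {a})" by blast
    then show False using ncS by auto
  qed
  then obtain a b where ab: "a \<in> S" "b \<in> S" "a \<noteq> b" by blast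
  then have "\<not> (\<forall>x\<in>S. collinear {a, b, x})"
    using collinear_triples[of a b S] ncS by (simp add: insert_absorb)
  then obtain c where c: "c \<in> S" "\<not> collinear {a, b, c}" by blast
  have apex: "S \<subseteq> {x, y, z, y + z - x}"
    if "x \<in> S" "y \<in> S" "z \<in> S" "\<not> collinear {x, y, z}" "isosceles_with_ratio l x y z" for x y z
  proof
    fix d assume d: "d \<in> S"
    have ne: "x \<noteq> y" "y \<noteq> z" "x \<noteq> z"
      using that(4) by (auto simp: insert_commute)
    show "d \<in> {x, y, z, y + z - x}"
      using fourth_point_general_position[OF sim that(1-3) d that(4) _ _ _ that(5)]
        gen[OF that(1,2) d] gen[OF that(1,3) d] gen[OF that(2,3) d] ne by blast
  qed
  have "isosceles_with_ratio l a b c \<or> isosceles_with_ratio l b a c \<or> isosceles_with_ratio l c a b"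
    using sim ab c unfolding similar_isosceles_triangles_def by blast
  moreover have "\<not> collinear {b, a, c}" "\<not> collinear {c, a, b}"
    using c by (simp_all add: insert_commute)
  ultimately show ?thesis
    using apex ab c that by meson
qed

section \<open>Sets with a collinear triple\<close>

lemma cosine_at_apex_or_base:
  assumes sim: "similar_isosceles_triangles l S"
    and S: "a \<in> S" "b \<in> S" "c \<in> S" and nc: "\<not> collinear {a, b, c}"
  shows "0 < l" "l < 2"
    "cosine_at a b c = l / 2 \<or> cosine_at a b c = 1 - l\<^sup>2 / 2 \<and> dist b a = dist b c"
proof -
  have nc': "\<not> collinear {b, a, c}" "\<not> collinear {c, a, b}"
    using nc by (simp_all add: insert_commute)
  have "isosceles_with_ratio l a b c \<or> isosceles_with_ratio l b a c \<or> isosceles_with_ratio l c a b"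
    using sim S nc unfolding similar_isosceles_triangles_def by blast
  then have "0 < l \<and> l < 2 \<and>
    (cosine_at a b c = l / 2 \<or> cosine_at a b c = 1 - l\<^sup>2 / 2 \<and> dist b a = dist b c)"
    using isosceles_cosines[OF nc] isosceles_cosines[OF nc'(1)] isosceles_cosines[OF nc'(2)]
    by (metis cosine_at_commute isosceles_with_ratio_def)
  then show "0 < l" "l < 2"
    "cosine_at a b c = l / 2 \<or> cosine_at a b c = 1 - l\<^sup>2 / 2 \<and> dist b a = dist b c"
    by blast+
qed

text \<open>The cosines at \<open>q\<close> in the triangles \<open>p q c\<close> and \<open>r q c\<close> are opposite. Two base cosines are
  both positive, and a base cosine opposite to an apex cosine gives \<open>(l - 2) * (l + 1) = 0\<close>, which
  \<open>0 < l < 2\<close> excludes. So \<open>q\<close> is the apex of both triangles and the cosine there is \<open>0\<close>.\<close>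

lemma right_angle_at_middle:
  assumes sim: "similar_isosceles_triangles l S"
    and S: "p \<in> S" "q \<in> S" "r \<in> S" "c \<in> S"
    and btw: "between (p, r) q" and ne: "p \<noteq> q" "q \<noteq> r"
    and nc: "\<not> collinear {p, q, c}"
  shows "(c - q) \<bullet> (p - q) = 0" "norm (c - q) = norm (p - q)" "r - q = - (p - q)"
proof -
  have col: "collinear {p, q, r}"
    using btw collinear_between_cases by (metis insert_commute)
  have nc': "\<not> collinear {r, q, c}"
    using collinear_3_trans[of p q r c] col nc ne by (auto simp: insert_commute)
  obtain t where t: "0 \<le> t" "t \<le> 1" "q = (1 - t) *\<^sub>R p + t *\<^sub>R r"
    using btw by (auto simp: between_mem_segment closed_segment_def)
  then have t1: "0 < t" "t < 1"
    using ne by (force simp: less_le)+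
  define k where "k = (1 - t) / t"
  have k: "k > 0" using t1 by (simp add: k_def)
  have "t *\<^sub>R (r - q) = - ((1 - t) *\<^sub>R (p - q))"
    by (subst (1 2) t(3)) (simp add: algebra_simps)
  then have "(1 / t) *\<^sub>R (t *\<^sub>R (r - q)) = (1 / t) *\<^sub>R (- ((1 - t) *\<^sub>R (p - q)))"
    by simp
  then have r: "r - q = - (k *\<^sub>R (p - q))"
    using t1 by (simp add: k_def)
  have neg: "cosine_at r q c = - cosine_at p q c"
    using k by (simp add: cosine_at_def r)
  note P = cosine_at_apex_or_base[OF sim S(1,2,4) nc]
  note R = cosine_at_apex_or_base[OF sim S(3,2,4) nc']
  have sqr: "l / 2 \<noteq> - (1 - l\<^sup>2 / 2)"
  proof
    assume "l / 2 = - (1 - l\<^sup>2 / 2)"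
    then have "(l - 2) * (l + 1) = 0"
      by (simp add: power2_eq_square algebra_simps)
    then show False using P(1,2) by simp
  qed
  have "cosine_at p q c = 0 \<and> dist q p = dist q c \<and> dist q r = dist q c"
    using P R neg sqr by (elim disjE conjE) linarith+
  then have z: "cosine_at p q c = 0" and d: "dist q p = dist q c" "dist q r = dist q c"
    by auto
  show n: "norm (c - q) = norm (p - q)"
    using d by (simp add: dist_norm norm_minus_commute)
  show "(c - q) \<bullet> (p - q) = 0"
    using z n ne by (auto simp: cosine_at_def inner_commute)
  have "norm (r - q) = norm (p - q)"
    using d by (simp add: dist_norm norm_minus_commute)
  then have "k = 1" using k ne by (simp add: r)
  then show "r - q = - (p - q)" using r by simp
qed

text \<open>The square with center \<open>q\<close> that has \<open>q + u\<close> as a vertex, together with its center.\<close>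

definition centered_square :: "real^2 \<Rightarrow> real^2 \<Rightarrow> (real^2) set" where
  "centered_square q u = {q, q + u, q - u, q + quarter_turn u, q - quarter_turn u}"

text \<open>A further point \<open>e\<close> on the line of \<open>p\<close>, \<open>q\<close>, \<open>r\<close> forms a collinear triple with \<open>p\<close> and \<open>q\<close>,
  and its middle point is the foot of the perpendicular from a point \<open>c\<close> off the line. That foot is
  \<open>q\<close>, hence \<open>e\<close> is the mirror image of \<open>p\<close> in \<open>q\<close>, which is \<open>r\<close>.\<close>

lemma collinear_triple_imp_subset_centered_square:
  assumes sim: "similar_isosceles_triangles l S" and ncS: "\<not> collinear S"
    and S: "p \<in> S" "q \<in> S" "r \<in> S"
    and btw: "between (p, r) q" and ne: "p \<noteq> q" "q \<noteq> r"
  shows "S \<subseteq> centered_square q (p - q)"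
proof -
  define u where "u = p - q"
  have u: "u \<noteq> 0" and p: "p = q + u" using ne by (simp_all add: u_def)
  note mid = right_angle_at_middle[OF sim]
  have "\<not> (\<forall>x\<in>S. collinear {p, q, x})"
    using collinear_triples[of p q S] ne ncS S by (simp add: insert_absorb)
  then obtain c where c: "c \<in> S" "\<not> collinear {p, q, c}" by blast
  have o: "(c - q) \<bullet> u = 0"
    using mid[OF S c(1) btw ne c(2)] by (simp add: u_def)
  have "e \<in> centered_square q u" if e: "e \<in> S" for e
  proof (cases "collinear {p, q, e}")
    case False
    have "e - q = quarter_turn u \<or> e - q = - quarter_turn u"
      using mid[OF S e btw ne False] orthogonal_real2_same_norm[OF u, of "e - q"]
      by (simp add: u_def)
    then show ?thesis
      by (auto simp: centered_square_def algebra_simps)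
  next
    case True
    show ?thesis
    proof (cases "e = p \<or> e = q")
      case True
      then show ?thesis by (auto simp: centered_square_def p)
    next
      case ne': False
      have ncep: "\<not> collinear {e, p, c}" "\<not> collinear {e, q, c}"
        using collinear_3_trans[of q p e c] collinear_3_trans[of p q e c] True c(2) ne'
        by (auto simp: insert_commute)
      consider "between (q, p) e" | "between (p, e) q" | "between (e, q) p"
        using True collinear_between_cases[of e q p] by (metis insert_commute)
      then show ?thesis
      proof cases
        case 1
        have ncqe: "\<not> collinear {q, e, c}" using ncep by (simp add: insert_commute)
        obtain t where "e = (1 - t) *\<^sub>R q + t *\<^sub>R p"
          using 1 by (auto simp: between_mem_segment closed_segment_def)
        then have e_eq: "e = q + t *\<^sub>R u" by (simp add: p algebra_simps)
        have "(c - e) \<bullet> (q - e) = 0"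
          using mid(1)[OF S(2) e S(1) c(1) 1 _ _ ncqe] ne' by auto
        then have "t = 0"
          using o u by (simp add: e_eq inner_diff_left inner_add_left algebra_simps)
        then show ?thesis using e_eq ne' by simp
      next
        case 2
        have "e - q = - (p - q)"
          using mid(3)[OF S(1,2) e c(1) 2 _ _ c(2)] ne ne' by auto
        then show ?thesis by (simp add: centered_square_def u_def algebra_simps)
      next
        case 3
        have "(c - p) \<bullet> (e - p) = 0" "q - p = - (e - p)"
          using mid(1,3)[OF e S(1,2) c(1) 3 _ _ ncep(1)] ne ne' by auto
        then have "(c - p) \<bullet> u = 0"
          by (simp add: u_def)
        then show ?thesis
          using o u by (simp add: p inner_diff_left inner_add_left)
      qed
    qed
  qed
  then show ?thesis by (auto simp: u_def)
qed

section \<open>Similarity and the square with its center\<close>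

lemma square_with_center_eq: "square_with_center = centered_square 0 (vector [1, 1])"
proof -
  have "quarter_turn (vector [1, 1]) = vector [- 1, 1]" "- quarter_turn (vector [1, 1]) = vector [1, - 1]"
    "- vector [1, 1] = (vector [- 1, - 1] :: real^2)" "vector [0, 0] = (0 :: real^2)"
    by (simp_all add: vec_eq_iff forall_2)
  then show ?thesis
    by (auto simp: square_with_center_def centered_square_def)
qed

text \<open>With \<open>J\<close> for the quarter turn and \<open>e = (1, 1)\<close>, the map
  \<open>x \<mapsto> ((u \<bullet> x) e + (J u \<bullet> x) J e) / \<bar>u\<bar>\<^sup>2\<close> sends \<open>u\<close> to \<open>e\<close> and \<open>J u\<close> to \<open>J e\<close>. Since
  \<open>u\<close>, \<open>J u\<close> and \<open>e\<close>, \<open>J e\<close> are orthogonal pairs of equal length, it is \<open>\<bar>e\<bar> / \<bar>u\<bar>\<close> times an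
  orthogonal map.\<close>

lemma centered_square_similar:
  assumes u: "u \<noteq> 0"
  shows "similar (centered_square q u) square_with_center"
proof -
  define e :: "real^2" where "e = vector [1, 1]"
  define g where "g x = (u \<bullet> x) *\<^sub>R e + (quarter_turn u \<bullet> x) *\<^sub>R quarter_turn e" for x
  define f where "f x = (1 / (sqrt 2 * norm u)) *\<^sub>R g x" for x
  define r where "r = sqrt 2 / norm u"
  have lin: "linear g"
    unfolding g_def by (intro linearI) (simp_all add: algebra_simps)
  have r: "r > 0" using u by (simp add: r_def)
  have rf: "r *\<^sub>R f x = (1 / (norm u)\<^sup>2) *\<^sub>R g x" for x
    by (simp add: r_def f_def power2_eq_square)
  have gu: "g u = (norm u)\<^sup>2 *\<^sub>R e" "g (quarter_turn u) = (norm u)\<^sup>2 *\<^sub>R quarter_turn e"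
    by (simp_all add: g_def vec_eq_iff forall_2 e_def power2_norm_eq_inner inner_real2)
  have "(norm (g x))\<^sup>2 = (sqrt 2 * norm u * norm x)\<^sup>2" for x
    unfolding power_mult_distrib power2_norm_eq_inner
    by (simp add: g_def e_def inner_real2 power2_eq_square algebra_simps)
  then have "norm (g x) = sqrt 2 * norm u * norm x" for x
    by (metis norm_ge_zero power2_eq_imp_eq mult_nonneg_nonneg real_sqrt_ge_zero zero_le_numeral)
  then have "norm (f x) = norm x" for x
    using u by (simp add: f_def)
  moreover have "linear f"
    unfolding f_def by (intro linear_compose_scale_right lin)
  ultimately have f: "orthogonal_transformation f"
    by (simp add: orthogonal_transformation)
  have "(\<lambda>x. - (r *\<^sub>R f q) + r *\<^sub>R f x) ` centered_square q u = centered_square 0 e"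
    using u by (simp add: centered_square_def rf linear_add[OF lin] linear_diff[OF lin] gu scaleR_add_right scaleR_diff_right)
  then show ?thesis
    unfolding similar_def square_with_center_eq using r f e_def by metis
qed

lemma similar_invariants:
  assumes "similar S T"
  shows "ecard S = ecard T" "admissible k S \<longleftrightarrow> admissible k T"
proof -
  obtain r f t where r: "r > 0" and f: "orthogonal_transformation f"
    and T: "T = (\<lambda>x. t + r *\<^sub>R f x) ` S"
    using assms unfolding similar_def by blast
  define h where "h x = t + r *\<^sub>R f x" for x
  have lin: "linear f" using f orthogonal_transformation_linear by blast
  have diff: "h a - h b = r *\<^sub>R f (a - b)" for a b
    by (simp add: h_def linear_diff[OF lin] algebra_simps)
  have inj: "inj h"
    using r orthogonal_transformation_inj[OF f] by (auto simp: inj_def h_def)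
  have Th: "T = h ` S" by (simp add: T h_def)
  have ang: "angle_at (h a) (h b) (h c) = angle_at a b c" for a b c
    using r f by (simp add: angle_at_def diff orthogonal_transformation_norm orthogonal_transformation_def)
  have "angles T = angles S"
  proof (intro set_eqI iffI)
    fix \<theta> assume "\<theta> \<in> angles T"
    then obtain a b c where "a \<in> S" "b \<in> S" "c \<in> S" "h a \<noteq> h b" "h b \<noteq> h c" "h a \<noteq> h c"
      and "\<theta> = angle_at (h a) (h b) (h c)" "\<theta> \<in> {0<..<pi}"
      unfolding angles_def Th by blast
    then have "\<theta> = angle_at a b c" "a \<noteq> b" "b \<noteq> c" "a \<noteq> c"
      by (auto simp: ang)
    then show "\<theta> \<in> angles S"
      using \<open>a \<in> S\<close> \<open>b \<in> S\<close> \<open>c \<in> S\<close> \<open>\<theta> \<in> {0<..<pi}\<close> unfolding angles_def by blast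
  next
    fix \<theta> assume "\<theta> \<in> angles S"
    then obtain a b c where abc: "a \<in> S" "b \<in> S" "c \<in> S" "a \<noteq> b" "b \<noteq> c" "a \<noteq> c"
      and \<theta>: "\<theta> = angle_at a b c" "\<theta> \<in> {0<..<pi}"
      unfolding angles_def by blast
    have "h a \<in> T" "h b \<in> T" "h c \<in> T" "h a \<noteq> h b" "h b \<noteq> h c" "h a \<noteq> h c"
      using abc by (auto simp: Th inj_eq[OF inj])
    moreover have "\<theta> = angle_at (h a) (h b) (h c)" by (simp add: ang \<theta>(1))
    ultimately show "\<theta> \<in> angles T"
      using \<theta>(2) unfolding angles_def by blast
  qed
  moreover have "collinear T \<longleftrightarrow> collinear S"
  proof -
    have "inj (\<lambda>x. r *\<^sub>R f x)" using inj by (simp add: inj_def h_def)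
    then have "aff_dim ((\<lambda>x. r *\<^sub>R f x) ` S) = aff_dim S"
      by (intro aff_dim_injective_linear_image linear_compose_scale_right lin)
    moreover have "T = (+) t ` (\<lambda>x. r *\<^sub>R f x) ` S" by (simp add: T image_image)
    ultimately show ?thesis by (simp add: collinear_aff_dim aff_dim_translation_eq)
  qed
  ultimately show "admissible k S \<longleftrightarrow> admissible k T"
    by (simp add: admissible_def num_angles_def)
  have "inj_on h S" using inj inj_on_subset by blast
  then show "ecard S = ecard T"
    by (simp add: Th ecard_def card_image finite_image_iff)
qed

text \<open>The vectors between the five points have integer coordinates, so a finite check of the inner
  product \<open>p\<close> against the product \<open>n\<close> of the norms can be made on \<open>p\<close>, \<open>p\<^sup>2\<close> and \<open>n\<^sup>2\<close>, free of
  square roots. The outcomes \<open>p\<^sup>2 = n\<^sup>2\<close> are the excluded angles \<open>0\<close> and \<open>\<pi>\<close>.\<close>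

lemma angles_square_with_center: "angles square_with_center \<subseteq> {pi / 4, pi / 2}"
proof
  fix \<theta> assume "\<theta> \<in> angles square_with_center"
  then obtain a b c where S: "a \<in> square_with_center" "b \<in> square_with_center" "c \<in> square_with_center"
    and ne: "a \<noteq> b" "b \<noteq> c" and th: "\<theta> = angle_at a b c" "0 < \<theta>" "\<theta> < pi"
    by (auto simp: angles_def)
  define p n where "p = (a - b) \<bullet> (c - b)" and "n = norm (a - b) * norm (c - b)"
  have n: "n > 0" using ne by (simp add: n_def)
  have n2: "n\<^sup>2 = ((a - b) \<bullet> (a - b)) * ((c - b) \<bullet> (c - b))"
    by (simp add: n_def power_mult_distrib power2_norm_eq_inner)
  have "p = 0 \<or> (p > 0 \<and> 2 * p\<^sup>2 = n\<^sup>2) \<or> p\<^sup>2 = n\<^sup>2"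
    using S unfolding n2 p_def square_with_center_def inner_real2
    by (elim insertE emptyE; simp)
  then consider "p = 0" | "p > 0" "2 * p\<^sup>2 = n\<^sup>2" | "p = n" | "p = - n"
    by (auto simp: power2_eq_iff)
  then show "\<theta> \<in> {pi / 4, pi / 2}"
  proof cases
    case 1
    then show ?thesis by (simp add: th angle_at_def p_def)
  next
    case 2
    have "n\<^sup>2 = (sqrt 2 * p)\<^sup>2" using 2 by (simp add: power_mult_distrib)
    then have "n = sqrt 2 * p" using n 2 by (simp add: power2_eq_iff_nonneg)
    then have "p / n = cos (pi / 4)"
      using 2 by (simp add: cos_45 field_simps)
    then have "\<theta> = arccos (cos (pi / 4))"
      by (simp add: th angle_at_def p_def n_def)
    then show ?thesis by (simp add: arccos_cos)
  next
    case 3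
    then show ?thesis using th n by (simp add: angle_at_def flip: p_def n_def)
  next
    case 4
    then show ?thesis using th n by (simp add: angle_at_def flip: p_def n_def)
  qed
qed

lemma card_centered_square_le: "card (centered_square q u) \<le> 5"
  using card_length[of "[q, q + u, q - u, q + quarter_turn u, q - quarter_turn u]"]
  by (simp add: centered_square_def)

lemma card_square_with_center: "card square_with_center = 5" "finite square_with_center"
  by (simp_all add: square_with_center_def vec_eq_iff forall_2)

lemma admissible_square_with_center: "admissible 2 square_with_center"
proof -
  have "finite (angles square_with_center)" "card (angles square_with_center) \<le> 2"
    using angles_square_with_center card_mono[OF _ angles_square_with_center] finite_subset
    by (auto simp: card_insert_if split: if_splits)
  moreover have "\<not> collinear square_with_center"
  proof
    assume "collinear square_with_center"
    then have "collinear {vector [1, 1], 0, vector [- 1, 1] :: real^2}"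
      by (rule collinear_subset) (auto simp: square_with_center_def vec_eq_iff forall_2)
    then have "collinear {0, vector [1, 1], vector [- 1, 1] :: real^2}"
      by (simp add: insert_commute)
    then show False
      by (auto simp: collinear_lemma vec_eq_iff forall_2)
  qed
  ultimately show ?thesis by (simp add: admissible_def num_angles_def ecard_def)
qed

section \<open>Optimal sets\<close>

lemma admissible_two_shape:
  assumes adm: "admissible 2 S"
  shows "(\<exists>a b c d. S \<subseteq> {a, b, c, d}) \<or> (\<exists>q u. u \<noteq> 0 \<and> S \<subseteq> centered_square q u)"
proof -
  obtain l where sim: "similar_isosceles_triangles l S"
    using admissible_imp_similar_isosceles_triangles[OF adm] .
  have ncS: "\<not> collinear S" using adm by (simp add: admissible_def)
  show ?thesis
  proof (cases "\<exists>a\<in>S. \<exists>b\<in>S. \<exists>c\<in>S. a \<noteq> b \<and> b \<noteq> c \<and> a \<noteq> c \<and> collinear {a, b, c}")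
    case True
    then obtain a b c where abc: "a \<in> S" "b \<in> S" "c \<in> S" "a \<noteq> b" "b \<noteq> c" "a \<noteq> c"
      and "between (b, c) a \<or> between (c, a) b \<or> between (a, b) c"
      using collinear_between_cases by metis
    then have "\<exists>p\<in>S. \<exists>q\<in>S. \<exists>r\<in>S. between (p, r) q \<and> p \<noteq> q \<and> q \<noteq> r"
      by blast
    then obtain p q r where "p \<in> S" "q \<in> S" "r \<in> S" "between (p, r) q" "p \<noteq> q" "q \<noteq> r"
      by blast
    then have "S \<subseteq> centered_square q (p - q)" "p - q \<noteq> 0"
      using collinear_triple_imp_subset_centered_square[OF sim ncS] by auto
    then show ?thesis by blast
  next
    case False
    then obtain a b c where "S \<subseteq> {a, b, c, b + c - a}"
      using no_collinear_triple_imp_four_points[OF sim ncS] by metis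
    then show ?thesis by blast
  qed
qed

theorem theorem1p5:
  shows "max_points 2 = 5 \<and> (\<forall>S. optimal 2 S \<longleftrightarrow> similar S square_with_center)"
proof -
  have four: "card {a, b, c, d} \<le> 4" for a b c d :: "real^2"
    by (simp add: card_insert_if)
  have bound: "finite S \<and> card S \<le> 5" if "admissible 2 S" for S
    using admissible_two_shape[OF that]
  proof (elim disjE exE conjE)
    fix a b c d assume "S \<subseteq> {a, b, c, d}"
    then show ?thesis
      using card_mono[of "{a, b, c, d}" S] four[of a b c d] finite_subset by fastforce
  next
    fix q u assume S: "S \<subseteq> centered_square q u"
    have fin: "finite (centered_square q u)" by (simp add: centered_square_def)
    show ?thesis
      using card_mono[OF fin S] card_centered_square_le[of q u] finite_subset[OF S fin] by simp
  qed
  have max: "max_points 2 = enat 5"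
    unfolding max_points_eq_iff[of 5 2, simplified]
    using bound card_square_with_center admissible_square_with_center by blast
  have "optimal 2 S \<longleftrightarrow> similar S square_with_center" for S
  proof
    assume "optimal 2 S"
    then have adm: "admissible 2 S" and card: "finite S" "card S = 5"
      by (auto simp: optimal_def max ecard_def split: if_splits)
    show "similar S square_with_center"
      using admissible_two_shape[OF adm]
    proof (elim disjE exE conjE)
      fix a b c d assume "S \<subseteq> {a, b, c, d}"
      then show ?thesis
        using card_mono[of "{a, b, c, d}" S] four[of a b c d] card by simp
    next
      fix q u assume u: "u \<noteq> 0" and S: "S \<subseteq> centered_square q u"
      have "S = centered_square q u"
        using S card card_centered_square_le[of q u]
        by (intro card_seteq) (simp_all add: centered_square_def)
      then show ?thesis using centered_square_similar[OF u] by simp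
    qed
  next
    assume "similar S square_with_center"
    then show "optimal 2 S"
      using similar_invariants[of S square_with_center] admissible_square_with_center card_square_with_center
      by (simp add: optimal_def max ecard_def)
  qed
  then show ?thesis using max by (simp add: numeral_eq_enat)
qed

end
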